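(* Let $\Omega$ be a domain in $\mathbb{R}^N$ and let $V\in L^1_{\mathrm{loc}}(\Omega)$, $V\ge 0$, be such that $$\mathcal{Q}_V(u):=\int_\Omega|\nabla u|^2\,dx-\int_\Omega Vu^2\,dx>0\quad\text{for all }u\in\mathcal{D}(\Omega)\setminus\{0\}.$$ Let $H$ be the completion of $\mathcal{D}(\Omega)$ with respect to the norm $[\mathcal{Q}_V(u)]^{1/2}$, and let $H^*$ be its dual space. Then for each $f\in H^*$ the problem $$-\Delta u-V(x)u=f(x)$$ has a unique solution $u\in H$.
   Context: $\mathcal{D}(\Omega)$ is the space of (real-valued) test functions on $\Omega$. $H$ is a Hilbert space whose inner product $(\cdot,\cdot)_H$ is the continuous extension of $(u,v)\mapsto\int_\Omega\nabla u\cdot\nabla v\,dx-\int_\Omega Vuv\,dx$ from $\mathcal{D}(\Omega)$. A solution $u\in H$ of $-\Delta u-Vu=f$ is understood in the weak sense: $(u,v)_H=\langle f,v\rangle$ for all $v\in H$ (equivalently, for all $v\in\mathcal{D}(\Omega)$). *)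

theory Defs
  imports "HOL-Analysis.Analysis"
begin

definition is_domain :: "(real ^ 'n) set \<Rightarrow> bool" where
  "is_domain \<Omega> \<longleftrightarrow> open \<Omega> \<and> connected \<Omega> \<and> \<Omega> \<noteq> {}"

text \<open>Functions on \<open>\<Omega>\<close> are represented by functions on the whole space. The values of a
  potential outside \<open>\<Omega>\<close> are irrelevant, and test functions are extended by zero.\<close>

definition L1_loc :: "(real ^ 'n) set \<Rightarrow> (real ^ 'n \<Rightarrow> real) \<Rightarrow> bool" where
  "L1_loc \<Omega> V \<longleftrightarrow> (\<forall>K. compact K \<and> K \<subseteq> \<Omega> \<longrightarrow> V absolutely_integrable_on K)"

definition partial_deriv :: "'n \<Rightarrow> (real ^ 'n \<Rightarrow> real) \<Rightarrow> real ^ 'n \<Rightarrow> real" where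
  "partial_deriv i u x = frechet_derivative u (at x) (axis i 1)"

definition grad :: "(real ^ 'n \<Rightarrow> real) \<Rightarrow> real ^ 'n \<Rightarrow> real ^ 'n" where
  "grad u x = (\<chi> i. partial_deriv i u x)"

primrec Ck :: "nat \<Rightarrow> (real ^ 'n \<Rightarrow> real) \<Rightarrow> bool" where
  "Ck 0 u \<longleftrightarrow> continuous_on UNIV u"
| "Ck (Suc k) u \<longleftrightarrow> (\<forall>x. u differentiable (at x)) \<and> (\<forall>i. Ck k (partial_deriv i u))"

definition test_functions :: "(real ^ 'n) set \<Rightarrow> (real ^ 'n \<Rightarrow> real) set" where
  "test_functions \<Omega> =
    {u. (\<forall>k. Ck k u) \<and> compact (closure {x. u x \<noteq> 0}) \<and> closure {x. u x \<noteq> 0} \<subseteq> \<Omega>}"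

definition energy_form ::
    "(real ^ 'n) set \<Rightarrow> (real ^ 'n \<Rightarrow> real) \<Rightarrow> (real ^ 'n \<Rightarrow> real) \<Rightarrow> (real ^ 'n \<Rightarrow> real) \<Rightarrow> real" where
  "energy_form \<Omega> V u v =
    (LINT x:\<Omega>|lebesgue. grad u x \<bullet> grad v x) - (LINT x:\<Omega>|lebesgue. V x * u x * v x)"

definition Q_form :: "(real ^ 'n) set \<Rightarrow> (real ^ 'n \<Rightarrow> real) \<Rightarrow> (real ^ 'n \<Rightarrow> real) \<Rightarrow> real" where
  "Q_form \<Omega> V u =
    (LINT x:\<Omega>|lebesgue. (norm (grad u x))\<^sup>2) - (LINT x:\<Omega>|lebesgue. V x * (u x)\<^sup>2)"

definition energy_norm :: "(real ^ 'n) set \<Rightarrow> (real ^ 'n \<Rightarrow> real) \<Rightarrow> (real ^ 'n \<Rightarrow> real) \<Rightarrow> real" where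
  "energy_norm \<Omega> V u = sqrt (Q_form \<Omega> V u)"

text \<open>The space \<open>H\<close> is the completion of the test functions under \<open>energy_norm\<close>: Cauchy sequences
  of test functions modulo sequences whose norm tends to zero. An element of \<open>H\<close> is an equivalence
  class of sequences; the operations below are meaningful for arguments in \<open>H_space \<Omega> V\<close>.\<close>

definition Cauchy_seqs ::
    "(real ^ 'n) set \<Rightarrow> (real ^ 'n \<Rightarrow> real) \<Rightarrow> (nat \<Rightarrow> real ^ 'n \<Rightarrow> real) set" where
  "Cauchy_seqs \<Omega> V =
    {s. (\<forall>n. s n \<in> test_functions \<Omega>) \<and>
        (\<forall>e>0. \<exists>M. \<forall>m\<ge>M. \<forall>n\<ge>M. energy_norm \<Omega> V (\<lambda>x. s m x - s n x) < e)}"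

definition null_rel ::
    "(real ^ 'n) set \<Rightarrow> (real ^ 'n \<Rightarrow> real) \<Rightarrow> (nat \<Rightarrow> real ^ 'n \<Rightarrow> real) rel" where
  "null_rel \<Omega> V =
    {(s, t). s \<in> Cauchy_seqs \<Omega> V \<and> t \<in> Cauchy_seqs \<Omega> V \<and>
             (\<lambda>n. energy_norm \<Omega> V (\<lambda>x. s n x - t n x)) \<longlonglongrightarrow> 0}"

definition H_space ::
    "(real ^ 'n) set \<Rightarrow> (real ^ 'n \<Rightarrow> real) \<Rightarrow> (nat \<Rightarrow> real ^ 'n \<Rightarrow> real) set set" where
  "H_space \<Omega> V = Cauchy_seqs \<Omega> V // null_rel \<Omega> V"

definition H_add ::
    "(real ^ 'n) set \<Rightarrow> (real ^ 'n \<Rightarrow> real) \<Rightarrow> (nat \<Rightarrow> real ^ 'n \<Rightarrow> real) set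
      \<Rightarrow> (nat \<Rightarrow> real ^ 'n \<Rightarrow> real) set \<Rightarrow> (nat \<Rightarrow> real ^ 'n \<Rightarrow> real) set" where
  "H_add \<Omega> V u v = (\<Union>s\<in>u. \<Union>t\<in>v. null_rel \<Omega> V `` {\<lambda>n x. s n x + t n x})"

definition H_scale ::
    "(real ^ 'n) set \<Rightarrow> (real ^ 'n \<Rightarrow> real) \<Rightarrow> real
      \<Rightarrow> (nat \<Rightarrow> real ^ 'n \<Rightarrow> real) set \<Rightarrow> (nat \<Rightarrow> real ^ 'n \<Rightarrow> real) set" where
  "H_scale \<Omega> V c u = (\<Union>s\<in>u. null_rel \<Omega> V `` {\<lambda>n x. c * s n x})"

text \<open>The continuous extension of \<open>energy_form\<close> to \<open>H\<close>; the limit does not depend on the chosen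
  representatives.\<close>

definition H_inner ::
    "(real ^ 'n) set \<Rightarrow> (real ^ 'n \<Rightarrow> real) \<Rightarrow> (nat \<Rightarrow> real ^ 'n \<Rightarrow> real) set
      \<Rightarrow> (nat \<Rightarrow> real ^ 'n \<Rightarrow> real) set \<Rightarrow> real" where
  "H_inner \<Omega> V u v =
    (THE r. \<forall>s\<in>u. \<forall>t\<in>v. (\<lambda>n. energy_form \<Omega> V (s n) (t n)) \<longlonglongrightarrow> r)"

definition H_norm ::
    "(real ^ 'n) set \<Rightarrow> (real ^ 'n \<Rightarrow> real) \<Rightarrow> (nat \<Rightarrow> real ^ 'n \<Rightarrow> real) set \<Rightarrow> real" where
  "H_norm \<Omega> V u = sqrt (H_inner \<Omega> V u u)"

text \<open>Continuous linear functionals on \<open>H\<close>; their values outside \<open>H_space \<Omega> V\<close> are irrelevant.\<close>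

definition H_dual ::
    "(real ^ 'n) set \<Rightarrow> (real ^ 'n \<Rightarrow> real) \<Rightarrow> ((nat \<Rightarrow> real ^ 'n \<Rightarrow> real) set \<Rightarrow> real) set" where
  "H_dual \<Omega> V =
    {f. (\<forall>u\<in>H_space \<Omega> V. \<forall>v\<in>H_space \<Omega> V. f (H_add \<Omega> V u v) = f u + f v) \<and>
        (\<forall>c. \<forall>u\<in>H_space \<Omega> V. f (H_scale \<Omega> V c u) = c * f u) \<and>
        (\<exists>C. \<forall>u\<in>H_space \<Omega> V. \<bar>f u\<bar> \<le> C * H_norm \<Omega> V u)}"

text \<open>Weak solutions in \<open>H\<close> of \<open>- \<Delta>u - V u = f\<close>.\<close>

definition weak_solution ::
    "(real ^ 'n) set \<Rightarrow> (real ^ 'n \<Rightarrow> real) \<Rightarrow> ((nat \<Rightarrow> real ^ 'n \<Rightarrow> real) set \<Rightarrow> real)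
      \<Rightarrow> (nat \<Rightarrow> real ^ 'n \<Rightarrow> real) set \<Rightarrow> bool" where
  "weak_solution \<Omega> V f u \<longleftrightarrow>
    u \<in> H_space \<Omega> V \<and> (\<forall>v\<in>H_space \<Omega> V. H_inner \<Omega> V u v = f v)"

end

theory Submission
  imports Defs
begin

text \<open>
  The problem is the Riesz representation theorem for the completion of the test functions, and the
  proof finds the solution by minimising the energy on the test functions themselves.

  Local integrability of \<open>V\<close> makes \<open>energy_form\<close> a symmetric bilinear form on test functions,
  since all integrands are products of an integrable function and a continuous function supported
  in a compact subset of \<open>\<Omega>\<close>. Positivity of \<open>Q_form\<close> gives the Cauchy--Schwarz inequality, hence a
  seminorm, and the limits that define the operations on \<open>H\<close> exist and do not depend on the
  representatives.

  A functional \<open>f\<close> in the dual restricts to a bounded linear functional \<open>\<phi>\<close> on test functions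
  (regarded as constant sequences). The functional \<open>J u = energy_form u u / 2 - \<phi> u\<close> is bounded
  below. If \<open>J (s n)\<close> exceeds the infimum by at most \<open>\<delta>\<close>, then the quadratic polynomial
  \<open>t \<mapsto> J (s n + t v) - inf J\<close> is nonnegative, and its discriminant shows that
  \<open>\<bar>energy_form (s n) v - \<phi> v\<bar> \<le> sqrt (2 * \<delta>) * energy_norm v\<close> for all \<open>v\<close> (lemma
  \<open>approximate_representation\<close>). As this is uniform in \<open>v\<close>, it gives two things at once: testing
  with \<open>v = s m - s n\<close> shows that \<open>s\<close> is a Cauchy sequence, and testing with the terms \<open>v = t n\<close>
  of another Cauchy sequence shows that the class of \<open>s\<close> solves the equation against every element
  of \<open>H\<close> (lemma \<open>weak_solution_exists\<close>). Uniqueness follows by testing the equation with the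
  difference of two solutions.
\<close>

section \<open>Test functions\<close>

lemma partial_deriv_add:
  assumes "u differentiable (at x)" "v differentiable (at x)"
  shows "partial_deriv i (\<lambda>x. u x + v x) x = partial_deriv i u x + partial_deriv i v x"
  using frechet_derivative_at[OF has_derivative_add[OF assms[unfolded frechet_derivative_works]]]
  unfolding partial_deriv_def by metis

lemma partial_deriv_scale:
  assumes "u differentiable (at x)"
  shows "partial_deriv i (\<lambda>x. c * u x) x = c * partial_deriv i u x"
  using frechet_derivative_at[OF has_derivative_mult_right[OF assms[unfolded frechet_derivative_works]]]
  unfolding partial_deriv_def by metis

lemma Ck_add: "Ck k u \<Longrightarrow> Ck k v \<Longrightarrow> Ck k (\<lambda>x. u x + v x)"
proof (induction k arbitrary: u v)
  case 0
  then show ?case by (auto intro: continuous_intros)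
next
  case (Suc k)
  have "partial_deriv i (\<lambda>x. u x + v x) = (\<lambda>x. partial_deriv i u x + partial_deriv i v x)" for i
    using Suc.prems by (intro ext partial_deriv_add) auto
  with Suc show ?case by auto
qed

lemma Ck_scale: "Ck k u \<Longrightarrow> Ck k (\<lambda>x. c * u x)"
proof (induction k arbitrary: u)
  case 0
  then show ?case by (auto intro: continuous_intros)
next
  case (Suc k)
  have "partial_deriv i (\<lambda>x. c * u x) = (\<lambda>x. c * partial_deriv i u x)" for i
    using Suc.prems by (intro ext partial_deriv_scale) auto
  with Suc show ?case by auto
qed

lemma Ck_zero: "Ck k (\<lambda>x :: real ^ 'n. 0)"
proof (induction k)
  case 0
  then show ?case by simp
next
  case (Suc k)
  have "partial_deriv i (\<lambda>x. 0) = (\<lambda>x. 0)" for i :: 'n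
    by (auto simp: partial_deriv_def fun_eq_iff)
  with Suc show ?case by simp
qed

lemma zero_outside_support: "x \<notin> closure {x. u x \<noteq> 0} \<Longrightarrow> u x = 0"
  using closure_subset[of "{x. u x \<noteq> 0}"] by auto

lemma test_functionsI:
  assumes "\<And>k. Ck k u" "compact K" "K \<subseteq> \<Omega>" "\<And>x. x \<notin> K \<Longrightarrow> u x = 0"
  shows "u \<in> test_functions \<Omega>"
proof -
  have "closure {x. u x \<noteq> 0} \<subseteq> K"
    using assms by (intro closure_minimal) (auto intro: compact_imp_closed)
  moreover have "compact (closure {x. u x \<noteq> 0})"
    using calculation assms(2) by (metis closed_closure compact_Int_closed inf.absorb_iff2)
  ultimately show ?thesis
    using assms by (auto simp: test_functions_def)
qed

lemma test_functionsD:
  assumes "u \<in> test_functions \<Omega>"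
  shows "u differentiable (at x)" "continuous_on UNIV u" "continuous_on UNIV (partial_deriv i u)"
proof -
  have "Ck 0 u" "Ck (Suc 0) u"
    using assms unfolding test_functions_def by blast+
  then show "u differentiable (at x)" "continuous_on UNIV u"
      "continuous_on UNIV (partial_deriv i u)"
    by auto
qed

lemma test_functions_zero: "(\<lambda>x. 0) \<in> test_functions \<Omega>"
  by (rule test_functionsI[of _ "{}"]) (auto intro: Ck_zero)

lemma test_functions_add:
  assumes "u \<in> test_functions \<Omega>" "v \<in> test_functions \<Omega>"
  shows "(\<lambda>x. u x + v x) \<in> test_functions \<Omega>"
proof (rule test_functionsI[of _ "closure {x. u x \<noteq> 0} \<union> closure {x. v x \<noteq> 0}"])
  fix x assume "x \<notin> closure {x. u x \<noteq> 0} \<union> closure {x. v x \<noteq> 0}"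
  then show "u x + v x = 0"
    using zero_outside_support[of x u] zero_outside_support[of x v] by simp
qed (use assms in \<open>auto simp: test_functions_def intro!: Ck_add compact_Un\<close>)

lemma test_functions_scale:
  assumes "u \<in> test_functions \<Omega>"
  shows "(\<lambda>x. c * u x) \<in> test_functions \<Omega>"
proof (rule test_functionsI[of _ "closure {x. u x \<noteq> 0}"])
  fix x assume "x \<notin> closure {x. u x \<noteq> 0}"
  then show "c * u x = 0"
    using zero_outside_support[of x u] by simp
qed (use assms in \<open>auto simp: test_functions_def intro!: Ck_scale\<close>)

lemma test_functions_diff:
  assumes "u \<in> test_functions \<Omega>" "v \<in> test_functions \<Omega>"
  shows "(\<lambda>x. u x - v x) \<in> test_functions \<Omega>"
  using test_functions_add[OF assms(1) test_functions_scale[OF assms(2), of "-1"]] by simp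

lemma grad_add:
  assumes "u \<in> test_functions \<Omega>" "v \<in> test_functions \<Omega>"
  shows "grad (\<lambda>x. u x + v x) x = grad u x + grad v x"
  using assms by (simp add: grad_def vec_eq_iff partial_deriv_add test_functionsD)

lemma grad_scale:
  assumes "u \<in> test_functions \<Omega>"
  shows "grad (\<lambda>x. c * u x) x = c *\<^sub>R grad u x"
  using assms by (simp add: grad_def vec_eq_iff partial_deriv_scale test_functionsD)

text \<open>On the open complement of the support \<open>u\<close> is locally the zero function.\<close>

lemma grad_eq_0:
  assumes "x \<notin> closure {x. u x \<noteq> 0}"
  shows "grad u x = 0"
proof -
  have "(u has_derivative (\<lambda>_. 0)) (at x)"
  proof (rule has_derivative_transform_within_open)
    show "((\<lambda>_. 0) has_derivative (\<lambda>_. 0)) (at x)" by simp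
    show "open (- closure {x. u x \<noteq> 0})" by auto
    show "x \<in> - closure {x. u x \<noteq> 0}" using assms by simp
    show "0 = u y" if "y \<in> - closure {x. u x \<noteq> 0}" for y
      using that zero_outside_support[of y u] by simp
  qed
  then have "frechet_derivative u (at x) = (\<lambda>_. 0)"
    by (metis frechet_derivative_at)
  then show ?thesis
    by (simp add: grad_def partial_deriv_def vec_eq_iff)
qed

lemma continuous_grad:
  assumes "u \<in> test_functions \<Omega>"
  shows "continuous_on UNIV (grad u)"
  using assms test_functionsD(3) unfolding grad_def by (intro continuous_intros) auto

section \<open>The energy form\<close>

text \<open>Both terms of \<open>energy_form\<close> have an integrand of this kind: \<open>W\<close> is \<open>1\<close> or the potential,
  and \<open>g\<close> is bounded because it is continuous and \<open>K\<close> is compact.\<close>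

lemma set_integrable_times_continuous:
  fixes g W :: "'a::euclidean_space \<Rightarrow> real"
  assumes K: "compact K" "K \<subseteq> \<Omega>" and W: "W absolutely_integrable_on K"
    and g: "continuous_on UNIV g" "\<And>x. x \<notin> K \<Longrightarrow> g x = 0"
  shows "set_integrable lebesgue \<Omega> (\<lambda>x. W x * g x)"
proof -
  have gK: "continuous_on K g"
    using g(1) continuous_on_subset by blast
  have "(\<lambda>x. g x * W x) absolutely_integrable_on K"
  proof (rule absolutely_integrable_bounded_measurable_product[OF bilinear_times])
    show "g \<in> borel_measurable (lebesgue_on K)"
      using gK K(1) by (intro continuous_imp_measurable_on_sets_lebesgue)
        (auto intro: fmeasurableD lmeasurable_compact)
    show "bounded (g ` K)"
      using gK K(1) by (intro compact_imp_bounded compact_continuous_image)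
  qed (use K W in \<open>auto intro: fmeasurableD lmeasurable_compact\<close>)
  moreover have "indicator \<Omega> x *\<^sub>R (W x * g x) = indicator K x *\<^sub>R (g x * W x)" for x
    using K(2) g(2)[of x] by (auto simp: indicator_def)
  ultimately show ?thesis
    by (simp only: set_integrable_def)
qed

lemma integrable_grad_inner:
  assumes "u \<in> test_functions \<Omega>" "v \<in> test_functions \<Omega>"
  shows "set_integrable lebesgue \<Omega> (\<lambda>x. grad u x \<bullet> grad v x)"
proof -
  let ?K = "closure {x. u x \<noteq> 0}"
  have "set_integrable lebesgue \<Omega> (\<lambda>x. 1 * (grad u x \<bullet> grad v x))"
  proof (rule set_integrable_times_continuous[of ?K])
    show K: "compact ?K" "?K \<subseteq> \<Omega>"
      using assms by (auto simp: test_functions_def)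
    show "(\<lambda>x. 1::real) absolutely_integrable_on ?K"
      using K(1) by (intro absolutely_integrable_on_const lmeasurable_compact)
    show "continuous_on UNIV (\<lambda>x. grad u x \<bullet> grad v x)"
      using assms by (intro continuous_intros continuous_grad)
  qed (simp add: grad_eq_0)
  then show ?thesis by simp
qed

lemma integrable_potential:
  assumes "L1_loc \<Omega> V" "u \<in> test_functions \<Omega>" "v \<in> test_functions \<Omega>"
  shows "set_integrable lebesgue \<Omega> (\<lambda>x. V x * u x * v x)"
proof -
  let ?K = "closure {x. u x \<noteq> 0}"
  have "set_integrable lebesgue \<Omega> (\<lambda>x. V x * (u x * v x))"
  proof (rule set_integrable_times_continuous[of ?K])
    show K: "compact ?K" "?K \<subseteq> \<Omega>"
      using assms by (auto simp: test_functions_def)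
    show "V absolutely_integrable_on ?K"
      using assms(1) K by (auto simp: L1_loc_def)
    show "continuous_on UNIV (\<lambda>x. u x * v x)"
      using assms by (intro continuous_intros test_functionsD(2))
    show "u x * v x = 0" if "x \<notin> ?K" for x
      using that zero_outside_support[of x u] by simp
  qed
  then show ?thesis by (simp add: mult.assoc)
qed

lemma energy_form_commute: "energy_form \<Omega> V u v = energy_form \<Omega> V v u"
  unfolding energy_form_def by (simp add: inner_commute ac_simps)

lemma Q_form_eq_energy_form: "Q_form \<Omega> V u = energy_form \<Omega> V u u"
  unfolding Q_form_def energy_form_def power2_norm_eq_inner by (simp add: power2_eq_square mult.assoc)

lemma energy_form_add_left:
  assumes "L1_loc \<Omega> V" "u \<in> test_functions \<Omega>" "v \<in> test_functions \<Omega>" "w \<in> test_functions \<Omega>"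
  shows "energy_form \<Omega> V (\<lambda>x. u x + v x) w = energy_form \<Omega> V u w + energy_form \<Omega> V v w"
proof -
  have "(LINT x:\<Omega>|lebesgue. (grad u x + grad v x) \<bullet> grad w x)
      = (LINT x:\<Omega>|lebesgue. grad u x \<bullet> grad w x) + (LINT x:\<Omega>|lebesgue. grad v x \<bullet> grad w x)"
    using assms by (simp add: inner_add_left set_integral_add integrable_grad_inner)
  moreover have "(LINT x:\<Omega>|lebesgue. V x * (u x + v x) * w x)
      = (LINT x:\<Omega>|lebesgue. V x * u x * w x) + (LINT x:\<Omega>|lebesgue. V x * v x * w x)"
    using assms by (simp add: distrib_left distrib_right set_integral_add integrable_potential)
  ultimately show ?thesis
    using assms by (simp add: energy_form_def grad_add)
qed

lemma energy_form_scale_left: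
  assumes "u \<in> test_functions \<Omega>"
  shows "energy_form \<Omega> V (\<lambda>x. c * u x) w = c * energy_form \<Omega> V u w"
proof -
  have "V x * (c * u x) * w x = c * (V x * u x * w x)" for x
    by simp
  then show ?thesis
    using assms by (simp only: energy_form_def grad_scale inner_scaleR_left
        set_integral_mult_right right_diff_distrib)
qed

text \<open>A nonnegative quadratic polynomial has a nonpositive discriminant. This yields both the
  Cauchy--Schwarz inequality and the estimate for approximate minimisers.\<close>

lemma nonneg_quadratic_discriminant:
  fixes a b c :: real
  assumes "\<And>t. 0 \<le> a + 2 * b * t + c * t\<^sup>2" "0 \<le> c"
  shows "b\<^sup>2 \<le> a * c"
proof (cases "c = 0")
  case True
  have "b = 0"
  proof (rule ccontr)
    assume "b \<noteq> 0"
    then show False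
      \<comment> \<open>At this point the linear function has the value \<open>- 1\<close>.\<close>
      using assms(1)[of "- (a + 1) / (2 * b)"] True by (simp add: field_simps)
  qed
  then show ?thesis using True by simp
next
  case False
  then have "c > 0" using assms(2) by simp
  \<comment> \<open>The minimum of the polynomial is attained at \<open>- b / c\<close>.\<close>
  have "0 \<le> a + 2 * b * (- b / c) + c * (- b / c)\<^sup>2"
    by (rule assms(1))
  also have "\<dots> = a - b\<^sup>2 / c"
    using \<open>c > 0\<close> by (simp add: field_simps power2_eq_square)
  finally show ?thesis
    using \<open>c > 0\<close> by (simp add: field_simps)
qed

text \<open>\<open>H\<close> identifies sequences whose distance tends to zero, so the seminorm of a
  positive semidefinite form becomes a norm on the completion.\<close>

locale nonneg_energy =
  fixes \<Omega> :: "(real ^ 'n) set" and V :: "real ^ 'n \<Rightarrow> real"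
  assumes locally_integrable: "L1_loc \<Omega> V"
    and Q_form_nonneg: "\<And>u. u \<in> test_functions \<Omega> \<Longrightarrow> 0 \<le> Q_form \<Omega> V u"
begin

abbreviation "D \<equiv> test_functions \<Omega>"
abbreviation "B \<equiv> energy_form \<Omega> V"
abbreviation "nrm \<equiv> energy_norm \<Omega> V"

lemmas D_closed = test_functions_add test_functions_diff test_functions_scale test_functions_zero

lemmas B_add_left = energy_form_add_left[OF locally_integrable]

lemma B_add_right:
  "u \<in> D \<Longrightarrow> v \<in> D \<Longrightarrow> w \<in> D \<Longrightarrow> B w (\<lambda>x. u x + v x) = B w u + B w v"
  by (simp add: energy_form_commute[of \<Omega> V w] B_add_left)

lemma B_scale_right: "u \<in> D \<Longrightarrow> B w (\<lambda>x. c * u x) = c * B w u"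
  by (simp add: energy_form_commute[of \<Omega> V w] energy_form_scale_left)

lemma B_diff_left:
  assumes "u \<in> D" "v \<in> D" "w \<in> D"
  shows "B (\<lambda>x. u x - v x) w = B u w - B v w"
  using B_add_left[OF assms(1) test_functions_scale[OF assms(2), of "-1"] assms(3)]
    energy_form_scale_left[OF assms(2), of V "-1" w] by simp

lemma B_diff_right:
  "u \<in> D \<Longrightarrow> v \<in> D \<Longrightarrow> w \<in> D \<Longrightarrow> B w (\<lambda>x. u x - v x) = B w u - B w v"
  by (simp add: energy_form_commute[of \<Omega> V w] B_diff_left)

lemma B_self_nonneg: "u \<in> D \<Longrightarrow> 0 \<le> B u u"
  using Q_form_nonneg by (simp add: Q_form_eq_energy_form)

lemma nrm_nonneg: "u \<in> D \<Longrightarrow> 0 \<le> nrm u"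
  using Q_form_nonneg by (simp add: energy_norm_def)

lemma nrm_square: "u \<in> D \<Longrightarrow> (nrm u)\<^sup>2 = B u u"
  using Q_form_nonneg[of u] by (simp add: energy_norm_def Q_form_eq_energy_form)

lemma B_add_scale_self:
  assumes "u \<in> D" "v \<in> D"
  shows "B (\<lambda>x. u x + t * v x) (\<lambda>x. u x + t * v x) = B u u + 2 * B u v * t + B v v * t\<^sup>2"
  using assms
  by (simp add: B_add_left B_add_right B_scale_right energy_form_scale_left D_closed
      energy_form_commute[of \<Omega> V v u] power2_eq_square algebra_simps)

lemma Cauchy_Schwarz:
  assumes "u \<in> D" "v \<in> D"
  shows "\<bar>B u v\<bar> \<le> nrm u * nrm v"
proof -
  have "(B u v)\<^sup>2 \<le> B u u * B v v"
  proof (rule nonneg_quadratic_discriminant)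
    show "0 \<le> B u u + 2 * B u v * t + B v v * t\<^sup>2" for t
      using B_self_nonneg[of "\<lambda>x. u x + t * v x"] B_add_scale_self[OF assms, of t] assms
      by (simp add: D_closed)
  qed (simp add: B_self_nonneg assms)
  also have "\<dots> = (nrm u * nrm v)\<^sup>2"
    using assms by (simp add: nrm_square power_mult_distrib)
  finally show ?thesis
    using assms by (simp add: abs_le_square_iff[symmetric] nrm_nonneg)
qed

lemma nrm_triangle:
  assumes "u \<in> D" "v \<in> D"
  shows "nrm (\<lambda>x. u x + v x) \<le> nrm u + nrm v"
proof (rule power2_le_imp_le)
  have "(nrm (\<lambda>x. u x + v x))\<^sup>2 = B u u + 2 * B u v + B v v"
    using B_add_scale_self[OF assms, of 1] assms by (simp add: nrm_square D_closed)
  also have "\<dots> \<le> (nrm u + nrm v)\<^sup>2"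
    using Cauchy_Schwarz[OF assms] assms by (simp add: power2_sum nrm_square)
  finally show "(nrm (\<lambda>x. u x + v x))\<^sup>2 \<le> (nrm u + nrm v)\<^sup>2" .
qed (simp add: assms nrm_nonneg)

lemma nrm_scale: "u \<in> D \<Longrightarrow> nrm (\<lambda>x. c * u x) = \<bar>c\<bar> * nrm u"
  by (simp add: energy_norm_def Q_form_eq_energy_form B_scale_right energy_form_scale_left
      real_sqrt_mult flip: mult.assoc)

lemma nrm_minus_commute:
  assumes "u \<in> D" "v \<in> D"
  shows "nrm (\<lambda>x. u x - v x) = nrm (\<lambda>x. v x - u x)"
  using nrm_scale[of "\<lambda>x. u x - v x" "-1"] assms by (simp add: D_closed)

lemma nrm_zero: "nrm (\<lambda>x. 0) = 0"
  using nrm_scale[OF test_functions_zero, of 0] by simp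

lemma nrm_diff_triangle:
  assumes "u \<in> D" "v \<in> D" "w \<in> D"
  shows "nrm (\<lambda>x. u x - w x) \<le> nrm (\<lambda>x. u x - v x) + nrm (\<lambda>x. v x - w x)"
  using nrm_triangle[of "\<lambda>x. u x - v x" "\<lambda>x. v x - w x"] assms by (simp add: D_closed)

lemma B_diff_bound:
  assumes "u \<in> D" "u' \<in> D" "v \<in> D" "v' \<in> D"
  shows "\<bar>B u v - B u' v'\<bar> \<le> nrm (\<lambda>x. u x - u' x) * nrm v + nrm u' * nrm (\<lambda>x. v x - v' x)"
proof -
  have "B u v - B u' v' = B (\<lambda>x. u x - u' x) v + B u' (\<lambda>x. v x - v' x)"
    using assms by (simp add: B_diff_left B_diff_right)
  then show ?thesis
    using Cauchy_Schwarz[of "\<lambda>x. u x - u' x" v] Cauchy_Schwarz[of u' "\<lambda>x. v x - v' x"] assms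
    by (simp add: D_closed)
qed

section \<open>The completion\<close>

lemma Cauchy_seqs_in_D: "s \<in> Cauchy_seqs \<Omega> V \<Longrightarrow> s n \<in> D"
  by (simp add: Cauchy_seqs_def)

lemma Cauchy_seqsD:
  assumes "s \<in> Cauchy_seqs \<Omega> V" "e > 0"
  shows "\<exists>M. \<forall>m\<ge>M. \<forall>n\<ge>M. nrm (\<lambda>x. s m x - s n x) < e"
  using assms unfolding Cauchy_seqs_def by blast

lemma Cauchy_seqs_add:
  assumes s: "s \<in> Cauchy_seqs \<Omega> V" and t: "t \<in> Cauchy_seqs \<Omega> V"
  shows "(\<lambda>n x. s n x + t n x) \<in> Cauchy_seqs \<Omega> V"
  unfolding Cauchy_seqs_def
proof (intro CollectI conjI allI impI)
  show "(\<lambda>x. s n x + t n x) \<in> D" for n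
    using s t by (simp add: D_closed Cauchy_seqs_in_D)
  fix e :: real assume "e > 0"
  then have e: "e / 2 > 0" by simp
  obtain M where M: "\<And>m n. m \<ge> M \<Longrightarrow> n \<ge> M \<Longrightarrow> nrm (\<lambda>x. s m x - s n x) < e / 2"
    using Cauchy_seqsD[OF s e] by blast
  obtain N where N: "\<And>m n. m \<ge> N \<Longrightarrow> n \<ge> N \<Longrightarrow> nrm (\<lambda>x. t m x - t n x) < e / 2"
    using Cauchy_seqsD[OF t e] by blast
  show "\<exists>M. \<forall>m\<ge>M. \<forall>n\<ge>M. nrm (\<lambda>x. s m x + t m x - (s n x + t n x)) < e"
  proof (intro exI allI impI)
    fix m n assume mn: "max M N \<le> m" "max M N \<le> n"
    have "nrm (\<lambda>x. (s m x - s n x) + (t m x - t n x))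
        \<le> nrm (\<lambda>x. s m x - s n x) + nrm (\<lambda>x. t m x - t n x)"
      using s t by (intro nrm_triangle) (auto simp: D_closed Cauchy_seqs_in_D)
    also have "\<dots> < e"
      using M[of m n] N[of m n] mn by simp
    finally show "nrm (\<lambda>x. s m x + t m x - (s n x + t n x)) < e"
      by (simp add: algebra_simps)
  qed
qed

lemma Cauchy_seqs_scale:
  assumes s: "s \<in> Cauchy_seqs \<Omega> V"
  shows "(\<lambda>n x. c * s n x) \<in> Cauchy_seqs \<Omega> V"
  unfolding Cauchy_seqs_def
proof (intro CollectI conjI allI impI)
  show "(\<lambda>x. c * s n x) \<in> D" for n
    using s by (simp add: D_closed Cauchy_seqs_in_D)
  fix e :: real assume "e > 0"
  then have e: "e / (\<bar>c\<bar> + 1) > 0" by simp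
  obtain M where M: "\<And>m n. m \<ge> M \<Longrightarrow> n \<ge> M \<Longrightarrow> nrm (\<lambda>x. s m x - s n x) < e / (\<bar>c\<bar> + 1)"
    using Cauchy_seqsD[OF s e] by blast
  show "\<exists>M. \<forall>m\<ge>M. \<forall>n\<ge>M. nrm (\<lambda>x. c * s m x - c * s n x) < e"
  proof (intro exI allI impI)
    fix m n assume mn: "M \<le> m" "M \<le> n"
    have d: "(\<lambda>x. s m x - s n x) \<in> D"
      using s by (simp add: D_closed Cauchy_seqs_in_D)
    have "\<bar>c\<bar> * nrm (\<lambda>x. s m x - s n x) \<le> (\<bar>c\<bar> + 1) * nrm (\<lambda>x. s m x - s n x)"
      using nrm_nonneg[OF d] by (simp add: algebra_simps)
    also have "\<dots> < e"
      using M[OF mn] by (simp add: field_simps)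
    finally show "nrm (\<lambda>x. c * s m x - c * s n x) < e"
      using nrm_scale[OF d, of c] by (simp add: algebra_simps)
  qed
qed

lemma Cauchy_seqs_diff:
  assumes "s \<in> Cauchy_seqs \<Omega> V" "t \<in> Cauchy_seqs \<Omega> V"
  shows "(\<lambda>n x. s n x - t n x) \<in> Cauchy_seqs \<Omega> V"
  using Cauchy_seqs_add[OF assms(1) Cauchy_seqs_scale[OF assms(2), of "-1"]] by simp

lemma Cauchy_seqs_const: "v \<in> D \<Longrightarrow> (\<lambda>n. v) \<in> Cauchy_seqs \<Omega> V"
  by (auto simp: Cauchy_seqs_def nrm_zero)

lemma Cauchy_seqs_bounded:
  assumes s: "s \<in> Cauchy_seqs \<Omega> V"
  obtains C where "C > 0" "\<And>n. nrm (s n) \<le> C"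
proof -
  obtain M where M: "\<And>m n. m \<ge> M \<Longrightarrow> n \<ge> M \<Longrightarrow> nrm (\<lambda>x. s m x - s n x) < 1"
    using Cauchy_seqsD[OF s zero_less_one] by blast
  define C where "C = 1 + (\<Sum>k\<le>M. nrm (s k))"
  have nn: "0 \<le> nrm (s k)" for k
    using s by (simp add: nrm_nonneg Cauchy_seqs_in_D)
  have le: "nrm (s k) \<le> C - 1" if "k \<le> M" for k
    unfolding C_def using that nn by (auto intro: member_le_sum)
  have "nrm (s n) \<le> C" for n
  proof (cases "n \<le> M")
    case True
    then show ?thesis using le by fastforce
  next
    case False
    have "nrm (\<lambda>x. (s n x - s M x) + s M x) \<le> nrm (\<lambda>x. s n x - s M x) + nrm (s M)"
      using s by (intro nrm_triangle) (auto simp: D_closed Cauchy_seqs_in_D)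
    also have "\<dots> \<le> C"
      using le[of M] M[of n M] False by simp
    finally show ?thesis by simp
  qed
  moreover have "C > 0"
    unfolding C_def using nn by (simp add: add_pos_nonneg sum_nonneg)
  ultimately show ?thesis using that by blast
qed

lemma nrm_tendsto_0:
  assumes "\<And>n. s n \<in> D" "\<And>n. nrm (s n) \<le> h n" "h \<longlonglongrightarrow> 0"
  shows "(\<lambda>n. nrm (s n)) \<longlonglongrightarrow> 0"
  using assms by (intro Lim_null_comparison[OF _ assms(3)]) (simp add: nrm_nonneg)

lemma equiv_null_rel: "equiv (Cauchy_seqs \<Omega> V) (null_rel \<Omega> V)"
proof (rule equivI)
  show "null_rel \<Omega> V \<subseteq> Cauchy_seqs \<Omega> V \<times> Cauchy_seqs \<Omega> V"
    by (auto simp: null_rel_def)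
  show "refl_on (Cauchy_seqs \<Omega> V) (null_rel \<Omega> V)"
    by (auto simp: refl_on_def null_rel_def nrm_zero)
  show "sym (null_rel \<Omega> V)"
  proof (rule symI)
    fix s t assume st: "(s, t) \<in> null_rel \<Omega> V"
    then have "nrm (\<lambda>x. s n x - t n x) = nrm (\<lambda>x. t n x - s n x)" for n
      by (intro nrm_minus_commute) (auto simp: null_rel_def Cauchy_seqs_in_D)
    with st show "(t, s) \<in> null_rel \<Omega> V"
      by (simp add: null_rel_def)
  qed
  show "trans (null_rel \<Omega> V)"
  proof (rule transI)
    fix s t r assume st: "(s, t) \<in> null_rel \<Omega> V" and tr: "(t, r) \<in> null_rel \<Omega> V"
    have C: "s \<in> Cauchy_seqs \<Omega> V" "t \<in> Cauchy_seqs \<Omega> V" "r \<in> Cauchy_seqs \<Omega> V"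
      using st tr by (auto simp: null_rel_def)
    have "(\<lambda>n. nrm (\<lambda>x. s n x - t n x) + nrm (\<lambda>x. t n x - r n x)) \<longlonglongrightarrow> 0 + 0"
      using st tr by (intro tendsto_add) (auto simp: null_rel_def)
    then have "(\<lambda>n. nrm (\<lambda>x. s n x - r n x)) \<longlonglongrightarrow> 0"
      using C by (intro nrm_tendsto_0[where h = "\<lambda>n. nrm (\<lambda>x. s n x - t n x) + nrm (\<lambda>x. t n x - r n x)"])
        (simp_all add: D_closed Cauchy_seqs_in_D nrm_diff_triangle)
    then show "(s, r) \<in> null_rel \<Omega> V"
      using C by (simp add: null_rel_def)
  qed
qed

abbreviation "cls s \<equiv> null_rel \<Omega> V `` {s}"

lemma cls_in_H_space: "s \<in> Cauchy_seqs \<Omega> V \<Longrightarrow> cls s \<in> H_space \<Omega> V"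
  by (simp add: H_space_def quotientI)

lemma H_spaceE:
  assumes "u \<in> H_space \<Omega> V"
  obtains s where "s \<in> Cauchy_seqs \<Omega> V" "u = cls s"
  using assms unfolding H_space_def by (blast elim: quotientE)

lemma H_add_cls:
  assumes "s \<in> Cauchy_seqs \<Omega> V" "t \<in> Cauchy_seqs \<Omega> V"
  shows "H_add \<Omega> V (cls s) (cls t) = cls (\<lambda>n x. s n x + t n x)"
  unfolding H_add_def
proof (rule UN_equiv_class2[OF equiv_null_rel equiv_null_rel _ assms])
  have "(\<lambda>n x. s n x + t n x, \<lambda>n x. s' n x + t' n x) \<in> null_rel \<Omega> V"
    if s: "(s, s') \<in> null_rel \<Omega> V" and t: "(t, t') \<in> null_rel \<Omega> V" for s s' t t'
  proof -
    have C: "s \<in> Cauchy_seqs \<Omega> V" "s' \<in> Cauchy_seqs \<Omega> V" "t \<in> Cauchy_seqs \<Omega> V" "t' \<in> Cauchy_seqs \<Omega> V"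
      using s t by (auto simp: null_rel_def)
    have le: "nrm (\<lambda>x. s n x + t n x - (s' n x + t' n x))
        \<le> nrm (\<lambda>x. s n x - s' n x) + nrm (\<lambda>x. t n x - t' n x)" for n
      using nrm_triangle[of "\<lambda>x. s n x - s' n x" "\<lambda>x. t n x - t' n x"] C
      by (simp add: D_closed Cauchy_seqs_in_D algebra_simps)
    have "(\<lambda>n. nrm (\<lambda>x. s n x - s' n x) + nrm (\<lambda>x. t n x - t' n x)) \<longlonglongrightarrow> 0 + 0"
      using s t by (intro tendsto_add) (auto simp: null_rel_def)
    then have "(\<lambda>n. nrm (\<lambda>x. s n x + t n x - (s' n x + t' n x))) \<longlonglongrightarrow> 0"
      using C by (intro nrm_tendsto_0[OF _ le]) (simp_all add: D_closed Cauchy_seqs_in_D)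
    then show ?thesis
      using C by (simp add: null_rel_def Cauchy_seqs_add)
  qed
  then show "congruent2 (null_rel \<Omega> V) (null_rel \<Omega> V) (\<lambda>s t. cls (\<lambda>n x. s n x + t n x))"
    by (auto simp: congruent2_def intro!: equiv_class_eq[OF equiv_null_rel])
qed

lemma H_scale_cls:
  assumes "s \<in> Cauchy_seqs \<Omega> V"
  shows "H_scale \<Omega> V c (cls s) = cls (\<lambda>n x. c * s n x)"
  unfolding H_scale_def
proof (rule UN_equiv_class[OF equiv_null_rel _ assms])
  have "(\<lambda>n x. c * s n x, \<lambda>n x. c * t n x) \<in> null_rel \<Omega> V" if s: "(s, t) \<in> null_rel \<Omega> V" for s t
  proof -
    have C: "s \<in> Cauchy_seqs \<Omega> V" "t \<in> Cauchy_seqs \<Omega> V"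
      using s by (auto simp: null_rel_def)
    have "nrm (\<lambda>x. c * s n x - c * t n x) = \<bar>c\<bar> * nrm (\<lambda>x. s n x - t n x)" for n
      using nrm_scale[of "\<lambda>x. s n x - t n x" c] C
      by (simp add: D_closed Cauchy_seqs_in_D algebra_simps)
    moreover have "(\<lambda>n. \<bar>c\<bar> * nrm (\<lambda>x. s n x - t n x)) \<longlonglongrightarrow> \<bar>c\<bar> * 0"
      using s by (intro tendsto_intros) (auto simp: null_rel_def)
    ultimately show ?thesis
      using C by (simp add: null_rel_def Cauchy_seqs_scale)
  qed
  then show "congruent (null_rel \<Omega> V) (\<lambda>s. cls (\<lambda>n x. c * s n x))"
    by (auto simp: congruent_def intro!: equiv_class_eq[OF equiv_null_rel])
qed

lemma B_convergent:
  assumes s: "s \<in> Cauchy_seqs \<Omega> V" and t: "t \<in> Cauchy_seqs \<Omega> V"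
  shows "convergent (\<lambda>n. B (s n) (t n))"
proof -
  obtain C where C: "C > 0" "\<And>n. nrm (s n) \<le> C" using Cauchy_seqs_bounded[OF s] by blast
  obtain C' where C': "C' > 0" "\<And>n. nrm (t n) \<le> C'" using Cauchy_seqs_bounded[OF t] by blast
  have "Cauchy (\<lambda>n. B (s n) (t n))"
  proof (rule metric_CauchyI)
    fix e :: real assume "e > 0"
    then have e: "e / (2 * C') > 0" "e / (2 * C) > 0" using C C' by auto
    obtain M where M: "\<And>m n. m \<ge> M \<Longrightarrow> n \<ge> M \<Longrightarrow> nrm (\<lambda>x. s m x - s n x) < e / (2 * C')"
      using Cauchy_seqsD[OF s e(1)] by blast
    obtain N where N: "\<And>m n. m \<ge> N \<Longrightarrow> n \<ge> N \<Longrightarrow> nrm (\<lambda>x. t m x - t n x) < e / (2 * C)"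
      using Cauchy_seqsD[OF t e(2)] by blast
    show "\<exists>M. \<forall>m\<ge>M. \<forall>n\<ge>M. dist (B (s m) (t m)) (B (s n) (t n)) < e"
    proof (intro exI allI impI)
      fix m n assume mn: "m \<ge> max M N" "n \<ge> max M N"
      have nn: "0 \<le> nrm (\<lambda>x. s m x - s n x)" "0 \<le> nrm (\<lambda>x. t m x - t n x)"
        using s t by (auto simp: nrm_nonneg D_closed Cauchy_seqs_in_D)
      have "\<bar>B (s m) (t m) - B (s n) (t n)\<bar>
          \<le> nrm (\<lambda>x. s m x - s n x) * nrm (t m) + nrm (s n) * nrm (\<lambda>x. t m x - t n x)"
        using s t by (intro B_diff_bound) (auto simp: Cauchy_seqs_in_D)
      also have "\<dots> \<le> nrm (\<lambda>x. s m x - s n x) * C' + C * nrm (\<lambda>x. t m x - t n x)"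
        using nn C C' by (intro add_mono mult_left_mono mult_right_mono) auto
      also have "\<dots> < e / 2 + e / 2"
        using M[of m n] N[of m n] mn C C' by (intro add_strict_mono) (auto simp: field_simps)
      finally show "dist (B (s m) (t m)) (B (s n) (t n)) < e"
        by (simp add: dist_real_def)
    qed
  qed
  then show ?thesis
    by (simp add: Cauchy_convergent_iff)
qed

lemma B_null_rel_tendsto_0:
  assumes s: "(s, s') \<in> null_rel \<Omega> V" and t: "(t, t') \<in> null_rel \<Omega> V"
  shows "(\<lambda>n. B (s n) (t n) - B (s' n) (t' n)) \<longlonglongrightarrow> 0"
proof -
  have Cs: "s \<in> Cauchy_seqs \<Omega> V" "s' \<in> Cauchy_seqs \<Omega> V" "t \<in> Cauchy_seqs \<Omega> V" "t' \<in> Cauchy_seqs \<Omega> V"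
    using s t by (auto simp: null_rel_def)
  obtain C where C: "C > 0" "\<And>n. nrm (s' n) \<le> C" using Cauchy_seqs_bounded[OF Cs(2)] by blast
  obtain C' where C': "C' > 0" "\<And>n. nrm (t n) \<le> C'" using Cauchy_seqs_bounded[OF Cs(3)] by blast
  let ?h = "\<lambda>n. nrm (\<lambda>x. s n x - s' n x) * C' + C * nrm (\<lambda>x. t n x - t' n x)"
  have "?h \<longlonglongrightarrow> 0 * C' + C * 0"
    using s t by (intro tendsto_intros) (auto simp: null_rel_def)
  then have h: "?h \<longlonglongrightarrow> 0" by simp
  have "norm (B (s n) (t n) - B (s' n) (t' n)) \<le> ?h n" for n
  proof -
    have nn: "0 \<le> nrm (\<lambda>x. s n x - s' n x)" "0 \<le> nrm (\<lambda>x. t n x - t' n x)"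
      using Cs by (auto simp: nrm_nonneg D_closed Cauchy_seqs_in_D)
    have "\<bar>B (s n) (t n) - B (s' n) (t' n)\<bar>
        \<le> nrm (\<lambda>x. s n x - s' n x) * nrm (t n) + nrm (s' n) * nrm (\<lambda>x. t n x - t' n x)"
      using Cs by (intro B_diff_bound) (auto simp: Cauchy_seqs_in_D)
    also have "\<dots> \<le> ?h n"
      using nn C C' by (intro add_mono mult_left_mono mult_right_mono) auto
    finally show ?thesis by simp
  qed
  then show ?thesis
    using h by (intro Lim_null_comparison[OF _ h]) simp
qed

text \<open>Turns the definite description in \<open>H_inner\<close> into a limit along one pair of representatives;
  every other pair gives the same limit because the difference tends to zero.\<close>

lemma H_inner_cls:
  assumes s: "s \<in> Cauchy_seqs \<Omega> V" and t: "t \<in> Cauchy_seqs \<Omega> V"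
    and lim: "(\<lambda>n. B (s n) (t n)) \<longlonglongrightarrow> r"
  shows "H_inner \<Omega> V (cls s) (cls t) = r"
  unfolding H_inner_def
proof (rule the_equality)
  show "\<forall>s'\<in>cls s. \<forall>t'\<in>cls t. (\<lambda>n. B (s' n) (t' n)) \<longlonglongrightarrow> r"
  proof (intro ballI)
    fix s' t' assume "s' \<in> cls s" "t' \<in> cls t"
    then have "(\<lambda>n. B (s n) (t n) - (B (s n) (t n) - B (s' n) (t' n))) \<longlonglongrightarrow> r - 0"
      by (intro tendsto_diff lim B_null_rel_tendsto_0) auto
    then show "(\<lambda>n. B (s' n) (t' n)) \<longlonglongrightarrow> r" by simp
  qed
  fix r' assume r': "\<forall>s'\<in>cls s. \<forall>t'\<in>cls t. (\<lambda>n. B (s' n) (t' n)) \<longlonglongrightarrow> r'"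
  have "s \<in> cls s" "t \<in> cls t"
    by (rule equiv_class_self[OF equiv_null_rel s] equiv_class_self[OF equiv_null_rel t])+
  with r' have "(\<lambda>n. B (s n) (t n)) \<longlonglongrightarrow> r'" by blast
  with lim show "r' = r" by (rule LIMSEQ_unique[rotated])
qed

lemma H_inner_cls_tendsto:
  assumes "s \<in> Cauchy_seqs \<Omega> V" "t \<in> Cauchy_seqs \<Omega> V"
  shows "(\<lambda>n. B (s n) (t n)) \<longlonglongrightarrow> H_inner \<Omega> V (cls s) (cls t)"
proof -
  obtain r where "(\<lambda>n. B (s n) (t n)) \<longlonglongrightarrow> r"
    using B_convergent[OF assms] unfolding convergent_def by blast
  then show ?thesis
    using H_inner_cls[OF assms] by blast
qed

lemma H_norm_cls_nonneg:
  assumes "s \<in> Cauchy_seqs \<Omega> V"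
  shows "0 \<le> H_norm \<Omega> V (cls s)"
proof -
  have "0 \<le> H_inner \<Omega> V (cls s) (cls s)"
    using assms by (intro LIMSEQ_le_const[OF H_inner_cls_tendsto[OF assms assms]])
      (simp add: B_self_nonneg Cauchy_seqs_in_D)
  then show ?thesis by (simp add: H_norm_def)
qed

lemma H_norm_cls_le:
  assumes s: "s \<in> Cauchy_seqs \<Omega> V" and le: "\<And>n. n \<ge> M \<Longrightarrow> nrm (s n) \<le> e"
  shows "H_norm \<Omega> V (cls s) \<le> e"
proof -
  have "0 \<le> nrm (s M)" using s by (simp add: nrm_nonneg Cauchy_seqs_in_D)
  then have e: "0 \<le> e" using le[of M] by linarith
  have "B (s n) (s n) \<le> e\<^sup>2" if "n \<ge> M" for n
    using power_mono[OF le[OF that], of 2] s by (simp add: nrm_square nrm_nonneg Cauchy_seqs_in_D)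
  then have "H_inner \<Omega> V (cls s) (cls s) \<le> e\<^sup>2"
    by (intro LIMSEQ_le_const2[OF H_inner_cls_tendsto[OF s s]]) blast
  then show ?thesis
    using e by (simp add: H_norm_def real_le_lsqrt)
qed

section \<open>Riesz representation\<close>

text \<open>The sequence \<open>s\<close> minimises the energy \<open>J u = B u u / 2 - \<phi> u\<close>. The Euler--Lagrange equation
  \<open>B u v = \<phi> v\<close> of the minimisation problem holds for \<open>s n\<close> up to an error that is uniform for \<open>v\<close>
  in the unit ball, because \<open>J\<close> can decrease only by \<open>inverse (Suc n)\<close> from \<open>s n\<close> in any
  direction.\<close>

lemma approximate_representation:
  assumes add: "\<And>u v. u \<in> D \<Longrightarrow> v \<in> D \<Longrightarrow> \<phi> (\<lambda>x. u x + v x) = \<phi> u + \<phi> v"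
    and scale: "\<And>c u. u \<in> D \<Longrightarrow> \<phi> (\<lambda>x. c * u x) = c * \<phi> u"
    and bound: "\<And>u. u \<in> D \<Longrightarrow> \<bar>\<phi> u\<bar> \<le> C * nrm u"
  obtains s \<epsilon> where "\<And>n. s n \<in> D" "\<epsilon> \<longlonglongrightarrow> (0::real)"
    "\<And>n v. v \<in> D \<Longrightarrow> \<bar>B (s n) v - \<phi> v\<bar> \<le> \<epsilon> n * nrm v"
proof -
  define J where "J u = B u u / 2 - \<phi> u" for u
  have "- (C\<^sup>2 / 2) \<le> J u" if u: "u \<in> D" for u
  proof -
    \<comment> \<open>Young's inequality absorbs the linear term into the quadratic one.\<close>
    have "0 \<le> (nrm u - C)\<^sup>2" by simp
    then have "C * nrm u \<le> B u u / 2 + C\<^sup>2 / 2"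
      by (simp add: power2_diff nrm_square[OF u] mult.commute)
    then show ?thesis
      unfolding J_def using bound[OF u] by linarith
  qed
  then have bdd: "bdd_below (J ` D)"
    by (intro bdd_belowI2)
  define m where "m = Inf (J ` D)"
  have m_le: "m \<le> J u" if "u \<in> D" for u
    unfolding m_def using bdd that by (intro cInf_lower) auto
  have "\<exists>u\<in>D. J u < m + inverse (Suc n)" for n
  proof -
    have "\<exists>y\<in>J ` D. y < m + inverse (Suc n)"
      unfolding m_def using test_functions_zero by (intro cInf_lessD) (auto simp: image_iff)
    then show ?thesis by blast
  qed
  then obtain s where s: "\<And>n. s n \<in> D" and J_s: "\<And>n. J (s n) < m + inverse (Suc n)"
    by metis
  show ?thesis
  proof
    show "s n \<in> D" for n by (rule s)
    have "(\<lambda>n. sqrt (2 * inverse (Suc n))) \<longlonglongrightarrow> sqrt (2 * 0)"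
      by (intro tendsto_intros LIMSEQ_inverse_real_of_nat)
    then show "(\<lambda>n. sqrt (2 * inverse (Suc n))) \<longlonglongrightarrow> 0" by simp
    fix n v assume v: "v \<in> D"
    define b where "b = B (s n) v - \<phi> v"
    have "(b / 2)\<^sup>2 \<le> inverse (Suc n) * (B v v / 2)"
    proof (rule nonneg_quadratic_discriminant)
      fix t :: real
      have "J (\<lambda>x. s n x + t * v x) = J (s n) + 2 * (b / 2) * t + B v v / 2 * t\<^sup>2"
        using s v unfolding J_def b_def
        by (simp add: B_add_scale_self add scale D_closed field_simps)
      moreover have "m \<le> J (\<lambda>x. s n x + t * v x)"
        using s v by (intro m_le) (simp add: D_closed)
      ultimately show "0 \<le> inverse (Suc n) + 2 * (b / 2) * t + B v v / 2 * t\<^sup>2"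
        using J_s[of n] by linarith
    qed (simp add: B_self_nonneg v)
    then have "b\<^sup>2 \<le> 2 * inverse (Suc n) * (nrm v)\<^sup>2"
      by (simp add: nrm_square v power_divide field_simps)
    then have "sqrt (b\<^sup>2) \<le> sqrt (2 * inverse (Suc n) * (nrm v)\<^sup>2)"
      by (rule real_sqrt_le_mono)
    then show "\<bar>B (s n) v - \<phi> v\<bar> \<le> sqrt (2 * inverse (Suc n)) * nrm v"
      using nrm_nonneg[OF v] by (simp add: real_sqrt_mult b_def)
  qed
qed

text \<open>With \<open>v = s m - s n\<close> the two error estimates give
  \<open>(nrm v)\<^sup>2 = B (s m) v - B (s n) v \<le> (\<epsilon> m + \<epsilon> n) * nrm v\<close>, so \<open>nrm v \<le> \<epsilon> m + \<epsilon> n\<close>.\<close>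

lemma approximate_representation_Cauchy:
  assumes s: "\<And>n. s n \<in> D" and \<epsilon>: "\<epsilon> \<longlonglongrightarrow> (0::real)"
    and approx: "\<And>n v. v \<in> D \<Longrightarrow> \<bar>B (s n) v - \<phi> v\<bar> \<le> \<epsilon> n * nrm v"
  shows "s \<in> Cauchy_seqs \<Omega> V"
  unfolding Cauchy_seqs_def
proof (intro CollectI conjI allI impI)
  show "s n \<in> D" for n by (rule s)
  fix e :: real assume e: "e > 0"
  then obtain M where M: "\<And>n. n \<ge> M \<Longrightarrow> \<bar>\<epsilon> n\<bar> < e / 2"
    using LIMSEQ_D[OF \<epsilon>, of "e / 2"] by auto
  show "\<exists>M. \<forall>m\<ge>M. \<forall>n\<ge>M. nrm (\<lambda>x. s m x - s n x) < e"
  proof (intro exI allI impI)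
    fix m n assume mn: "M \<le> m" "M \<le> n"
    let ?v = "\<lambda>x. s m x - s n x"
    have v: "?v \<in> D" using s by (simp add: D_closed)
    have "nrm ?v * nrm ?v = B (s m) ?v - B (s n) ?v"
      using s v by (simp add: nrm_square[OF v, unfolded power2_eq_square] B_diff_left)
    also have "\<dots> \<le> (\<epsilon> m + \<epsilon> n) * nrm ?v"
      using approx[OF v, of m] approx[OF v, of n] by (simp add: distrib_right)
    finally have "nrm ?v * nrm ?v \<le> (\<epsilon> m + \<epsilon> n) * nrm ?v" .
    then have "nrm ?v = 0 \<or> nrm ?v \<le> \<epsilon> m + \<epsilon> n"
      using nrm_nonneg[OF v] by (auto simp: mult_le_cancel_right)
    then show "nrm ?v < e"
      using M[OF mn(1)] M[OF mn(2)] e by auto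
  qed
qed

lemma dual_cls_add:
  assumes "f \<in> H_dual \<Omega> V" "s \<in> Cauchy_seqs \<Omega> V" "t \<in> Cauchy_seqs \<Omega> V"
  shows "f (cls (\<lambda>n x. s n x + t n x)) = f (cls s) + f (cls t)"
proof -
  have "f (H_add \<Omega> V (cls s) (cls t)) = f (cls s) + f (cls t)"
    using assms(1) cls_in_H_space[OF assms(2)] cls_in_H_space[OF assms(3)]
    unfolding H_dual_def by blast
  then show ?thesis
    by (simp only: H_add_cls[OF assms(2,3)])
qed

lemma dual_cls_scale:
  assumes "f \<in> H_dual \<Omega> V" "s \<in> Cauchy_seqs \<Omega> V"
  shows "f (cls (\<lambda>n x. c * s n x)) = c * f (cls s)"
proof -
  have "f (H_scale \<Omega> V c (cls s)) = c * f (cls s)"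
    using assms(1) cls_in_H_space[OF assms(2)] unfolding H_dual_def by fast
  then show ?thesis
    by (simp only: H_scale_cls[OF assms(2)])
qed

text \<open>The class of \<open>t\<close> is the limit in \<open>H\<close> of the classes of its terms, regarded as constant
  sequences: for large \<open>k\<close>, almost all terms of \<open>\<lambda>n. t n - t k\<close> are small, hence so is the norm of
  its class. A continuous functional is therefore determined by its values on test functions.\<close>

lemma dual_cls_tendsto:
  assumes f: "f \<in> H_dual \<Omega> V" and t: "t \<in> Cauchy_seqs \<Omega> V"
  shows "(\<lambda>k. f (cls (\<lambda>n. t k))) \<longlonglongrightarrow> f (cls t)"
proof (rule LIMSEQ_I)
  fix e :: real assume "e > 0"
  obtain C where C: "\<And>u. u \<in> H_space \<Omega> V \<Longrightarrow> \<bar>f u\<bar> \<le> C * H_norm \<Omega> V u"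
    using f unfolding H_dual_def by blast
  have e: "e / (\<bar>C\<bar> + 1) > 0" using \<open>e > 0\<close> by simp
  obtain M where M: "\<And>m n. m \<ge> M \<Longrightarrow> n \<ge> M \<Longrightarrow> nrm (\<lambda>x. t m x - t n x) < e / (\<bar>C\<bar> + 1)"
    using Cauchy_seqsD[OF t e] by blast
  have "\<bar>f (cls (\<lambda>n. t k)) - f (cls t)\<bar> < e" if k: "k \<ge> M" for k
  proof -
    have c: "(\<lambda>n. t k) \<in> Cauchy_seqs \<Omega> V"
      using t by (intro Cauchy_seqs_const Cauchy_seqs_in_D)
    let ?d = "\<lambda>n x. t n x + (-1) * t k x"
    have c': "(\<lambda>n x. (-1) * t k x) \<in> Cauchy_seqs \<Omega> V"
      by (rule Cauchy_seqs_scale[OF c])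
    have d: "?d \<in> Cauchy_seqs \<Omega> V"
      by (rule Cauchy_seqs_add[OF t c'])
    have "f (cls ?d) = f (cls t) + (-1) * f (cls (\<lambda>n. t k))"
      by (simp only: dual_cls_add[OF f t c'] dual_cls_scale[OF f c])
    then have "\<bar>f (cls (\<lambda>n. t k)) - f (cls t)\<bar> = \<bar>f (cls ?d)\<bar>"
      by simp
    also have "\<dots> \<le> C * H_norm \<Omega> V (cls ?d)"
      by (rule C[OF cls_in_H_space[OF d]])
    also have "\<dots> \<le> \<bar>C\<bar> * H_norm \<Omega> V (cls ?d)"
      using H_norm_cls_nonneg[OF d] by (intro mult_right_mono) auto
    also have "\<dots> \<le> \<bar>C\<bar> * (e / (\<bar>C\<bar> + 1))"
      using M[OF _ k] by (intro mult_left_mono H_norm_cls_le[OF d, of M]) (auto intro: less_imp_le)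
    also have "\<dots> < e"
      using \<open>e > 0\<close> by (simp add: field_simps)
    finally show ?thesis .
  qed
  then show "\<exists>M. \<forall>k\<ge>M. norm (f (cls (\<lambda>n. t k)) - f (cls t)) < e"
    by auto
qed

lemma weak_solution_exists:
  assumes f: "f \<in> H_dual \<Omega> V"
  shows "\<exists>u. weak_solution \<Omega> V f u"
proof -
  define \<phi> where "\<phi> v = f (cls (\<lambda>n. v))" for v
  obtain C where C: "\<And>u. u \<in> H_space \<Omega> V \<Longrightarrow> \<bar>f u\<bar> \<le> C * H_norm \<Omega> V u"
    using f unfolding H_dual_def by blast
  obtain s \<epsilon> where s: "\<And>n. s n \<in> D" and \<epsilon>: "\<epsilon> \<longlonglongrightarrow> (0::real)"
    and approx: "\<And>n v. v \<in> D \<Longrightarrow> \<bar>B (s n) v - \<phi> v\<bar> \<le> \<epsilon> n * nrm v"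
  proof (rule approximate_representation[of \<phi> "\<bar>C\<bar>"])
    fix u v assume u: "u \<in> D" and v: "v \<in> D"
    show "\<phi> (\<lambda>x. u x + v x) = \<phi> u + \<phi> v"
      unfolding \<phi>_def by (rule dual_cls_add[OF f Cauchy_seqs_const[OF u] Cauchy_seqs_const[OF v]])
  next
    fix c u assume u: "u \<in> D"
    show "\<phi> (\<lambda>x. c * u x) = c * \<phi> u"
      unfolding \<phi>_def by (rule dual_cls_scale[OF f Cauchy_seqs_const[OF u]])
  next
    fix u assume u: "u \<in> D"
    note u' = Cauchy_seqs_const[OF u]
    have "\<bar>\<phi> u\<bar> \<le> C * H_norm \<Omega> V (cls (\<lambda>n. u))"
      unfolding \<phi>_def by (rule C[OF cls_in_H_space[OF u']])
    also have "\<dots> \<le> \<bar>C\<bar> * H_norm \<Omega> V (cls (\<lambda>n. u))"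
      using H_norm_cls_nonneg[OF u'] by (intro mult_right_mono) auto
    also have "\<dots> \<le> \<bar>C\<bar> * nrm u"
      by (intro mult_left_mono H_norm_cls_le[OF u']) auto
    finally show "\<bar>\<phi> u\<bar> \<le> \<bar>C\<bar> * nrm u" .
  qed blast
  have sC: "s \<in> Cauchy_seqs \<Omega> V"
    using s \<epsilon> approx by (rule approximate_representation_Cauchy)
  have "H_inner \<Omega> V (cls s) v = f v" if vH: "v \<in> H_space \<Omega> V" for v
  proof -
    obtain t where t: "t \<in> Cauchy_seqs \<Omega> V" and v: "v = cls t"
      by (rule H_spaceE[OF vH])
    obtain M where M: "M > 0" "\<And>n. nrm (t n) \<le> M" using Cauchy_seqs_bounded[OF t] by blast
    have "(\<lambda>n. B (s n) (t n) - \<phi> (t n)) \<longlonglongrightarrow> 0"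
    proof (rule Lim_null_comparison)
      show "\<forall>\<^sub>F n in sequentially. norm (B (s n) (t n) - \<phi> (t n)) \<le> \<bar>\<epsilon> n\<bar> * M"
      proof (intro always_eventually allI)
        fix n
        have tn: "t n \<in> D" using t by (rule Cauchy_seqs_in_D)
        have "\<bar>B (s n) (t n) - \<phi> (t n)\<bar> \<le> \<epsilon> n * nrm (t n)"
          by (rule approx[OF tn])
        also have "\<dots> \<le> \<bar>\<epsilon> n\<bar> * M"
          using M nrm_nonneg[OF tn] by (intro mult_mono) auto
        finally show "norm (B (s n) (t n) - \<phi> (t n)) \<le> \<bar>\<epsilon> n\<bar> * M" by simp
      qed
      show "(\<lambda>n. \<bar>\<epsilon> n\<bar> * M) \<longlonglongrightarrow> 0"
        using tendsto_mult_right[OF tendsto_rabs_zero[OF \<epsilon>], of M] by simp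
    qed
    from tendsto_add[OF this dual_cls_tendsto[OF f t, folded \<phi>_def]]
    have "(\<lambda>n. B (s n) (t n)) \<longlonglongrightarrow> f v"
      by (simp add: v)
    then show ?thesis
      unfolding v by (rule H_inner_cls[OF sC t])
  qed
  then have "weak_solution \<Omega> V f (cls s)"
    using cls_in_H_space[OF sC] by (simp add: weak_solution_def)
  then show ?thesis ..
qed

text \<open>If \<open>d\<close> is the difference of representatives of two solutions, subtracting the equations tested
  with the class of \<open>d\<close> shows that \<open>Q_form (d n)\<close> tends to zero.\<close>

lemma weak_solution_unique:
  assumes "weak_solution \<Omega> V f u" "weak_solution \<Omega> V f u'"
  shows "u = u'"
proof -
  obtain s where s: "s \<in> Cauchy_seqs \<Omega> V" and u: "u = cls s"
    using assms(1) H_spaceE unfolding weak_solution_def by blast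
  obtain s' where s': "s' \<in> Cauchy_seqs \<Omega> V" and u': "u' = cls s'"
    using assms(2) H_spaceE unfolding weak_solution_def by blast
  define d where "d = (\<lambda>n x. s n x - s' n x)"
  have d: "d \<in> Cauchy_seqs \<Omega> V"
    unfolding d_def by (rule Cauchy_seqs_diff[OF s s'])
  have eq: "H_inner \<Omega> V (cls s) (cls d) = H_inner \<Omega> V (cls s') (cls d)"
    using assms cls_in_H_space[OF d] by (simp add: weak_solution_def u u')
  have "(\<lambda>n. B (s n) (d n) - B (s' n) (d n)) \<longlonglongrightarrow> 0"
    using tendsto_diff[OF H_inner_cls_tendsto[OF s d] H_inner_cls_tendsto[OF s' d]]
    by (simp add: eq)
  moreover have "B (s n) (d n) - B (s' n) (d n) = Q_form \<Omega> V (d n)" for n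
    using B_diff_left[of "s n" "s' n" "d n"] s s' d
    by (simp add: Cauchy_seqs_in_D Q_form_eq_energy_form) (simp add: d_def)
  ultimately have "(\<lambda>n. sqrt (Q_form \<Omega> V (d n))) \<longlonglongrightarrow> sqrt 0"
    by (intro tendsto_real_sqrt) simp
  then have "(s, s') \<in> null_rel \<Omega> V"
    using s s' by (simp add: null_rel_def energy_norm_def d_def)
  then show ?thesis
    unfolding u u' by (rule equiv_class_eq[OF equiv_null_rel])
qed

end

theorem theorem1p1:
  fixes \<Omega> :: "(real ^ 'n) set" and V :: "real ^ 'n \<Rightarrow> real"
  assumes "is_domain \<Omega>"
    and "L1_loc \<Omega> V"
    and "AE x in lebesgue. x \<in> \<Omega> \<longrightarrow> 0 \<le> V x"
    and "\<forall>u \<in> test_functions \<Omega> - {\<lambda>x. 0}. Q_form \<Omega> V u > 0"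
  shows "\<forall>f \<in> H_dual \<Omega> V. \<exists>!u. weak_solution \<Omega> V f u"
proof -
  interpret nonneg_energy \<Omega> V
  proof
    fix u assume u: "u \<in> test_functions \<Omega>"
    show "0 \<le> Q_form \<Omega> V u"
    proof (cases "u = (\<lambda>x. 0)")
      case True
      then show ?thesis
        using energy_form_scale_left[OF u, of V 0 u] by (simp add: Q_form_eq_energy_form)
    next
      case False
      with u assms(4) show ?thesis by (simp add: less_imp_le)
    qed
  qed (rule assms(2))
  show ?thesis
    using weak_solution_exists weak_solution_unique by blast
qed

end
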